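(* Let $G=(V,E)$ be a finite simple undirected unweighted graph with $E\neq\emptyset$, and let $c$ be the minimum number of edges that must be removed from $G$ so that every connected component of the remaining graph is a clique (the cluster deletion value of $G$). Then there exists a family of at most $c+1$ clusterings of $V$, and $c+1\le |E|$, such that for every $\lambda\in(0,1)$ the family contains a clustering that is optimal for the LambdaPrime objective with parameter $\lambda$.
   Context: A clustering of $V$ is a partition $\mathcal{C}$ of $V$ into disjoint nonempty sets. For $S\subseteq V$, $\mathrm{cut}(S)$ denotes the number of edges with exactly one endpoint in $S$. For $\lambda\in(0,1)$, the LambdaPrime objective of a clustering $\mathcal{C}$ is $\mathrm{LamPrime}(\mathcal{C},\lambda)=\sum_{S\in\mathcal{C}}\left(\tfrac12\,\mathrm{cut}(S)+\lambda\binom{|S|}{2}\right)$, and a clustering is optimal for parameter $\lambda$ if it minimizes this quantity over all clusterings of $V$. *)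

theory Defs
  imports Complex_Main "HOL-Library.Ramsey" "HOL-Library.Disjoint_Sets"
begin

text \<open>A graph is given by its vertex set \<open>V\<close> and its set \<open>E\<close> of edges, the edges being
  two-element subsets of \<open>V\<close>. Clusterings of \<open>V\<close> are the set partitions of \<open>V\<close>
  in the sense of \<^const>\<open>partition_on\<close>.\<close>

definition finite_simple_graph :: "'a set \<Rightarrow> 'a set set \<Rightarrow> bool" where
  "finite_simple_graph V E \<longleftrightarrow> finite V \<and> E \<subseteq> nsets V 2"

definition adj_rel :: "'a set set \<Rightarrow> 'a rel" where
  "adj_rel E = {(u, v). {u, v} \<in> E}"

definition connected_components :: "'a set \<Rightarrow> 'a set set \<Rightarrow> 'a set set" where
  "connected_components V E = (\<lambda>u. {v \<in> V. (u, v) \<in> (adj_rel E)\<^sup>*}) ` V"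

definition cluster_graph :: "'a set \<Rightarrow> 'a set set \<Rightarrow> bool" where
  "cluster_graph V E \<longleftrightarrow> (\<forall>K \<in> connected_components V E. clique K E)"

text \<open>For a finite graph the minimum below is attained, since deleting all of \<open>E\<close>
  leaves only single vertices.\<close>

definition cluster_deletion_value :: "'a set \<Rightarrow> 'a set set \<Rightarrow> nat" where
  "cluster_deletion_value V E = (LEAST k. \<exists>R \<subseteq> E. card R = k \<and> cluster_graph V (E - R))"

definition cut :: "'a set set \<Rightarrow> 'a set \<Rightarrow> nat" where
  "cut E S = card {e \<in> E. card (e \<inter> S) = 1}"

definition LamPrime :: "'a set set \<Rightarrow> 'a set set \<Rightarrow> real \<Rightarrow> real" where
  "LamPrime E C l = (\<Sum>S \<in> C. 1 / 2 * real (cut E S) + l * real (card S choose 2))"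

definition optimal_clustering :: "'a set \<Rightarrow> 'a set set \<Rightarrow> real \<Rightarrow> 'a set set \<Rightarrow> bool" where
  "optimal_clustering V E l C \<longleftrightarrow>
     partition_on V C \<and> (\<forall>D. partition_on V D \<longrightarrow> LamPrime E C l \<le> LamPrime E D l)"

end

theory Submission
  imports Defs
begin

text \<open>Write \<open>LamPrime C \<lambda> = x + \<lambda> y\<close>, where \<open>x\<close> is the integer number of edges between clusters
  and \<open>y\<close> the number of vertex pairs inside clusters. Since \<open>y \<ge> card E - x\<close>, with equality when
  all clusters are cliques, comparing an optimal clustering with an optimal cluster deletion gives
  \<open>(1 - \<lambda>) x \<le> (1 - \<lambda>) c\<close>, i.e. \<open>x \<in> {0..c}\<close>. For each such \<open>x\<close> one clustering suffices,
  namely one with the least \<open>y\<close>.\<close>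

definition inter_edges :: "'a set set \<Rightarrow> 'a set set \<Rightarrow> 'a set set" where
  "inter_edges E C = {e \<in> E. \<not> (\<exists>S \<in> C. e \<subseteq> S)}"

definition intra_pairs :: "'a set set \<Rightarrow> nat" where
  "intra_pairs C = (\<Sum>S \<in> C. card S choose 2)"

lemma finite_simple_graphD:
  assumes "finite_simple_graph V E"
  shows "finite V" "finite E" "E \<subseteq> nsets V 2"
  using assms finite_imp_finite_nsets finite_subset unfolding finite_simple_graph_def by blast+

text \<open>If both ends of \<open>e\<close> lie in one cluster, \<open>e\<close> meets it in two
  vertices and every other cluster in none; otherwise the two clusters of its ends each meet it
  once.\<close>

lemma card_clusters_meeting_edge_once:
  assumes C: "partition_on V C" and e: "e \<in> nsets V 2"
  shows "card {S \<in> C. card (e \<inter> S) = 1} = (if \<exists>S \<in> C. e \<subseteq> S then 0 else 2)"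
proof -
  obtain a b where ab: "e = {a, b}" "a \<noteq> b" "a \<in> V" "b \<in> V"
    using e by (auto simp: nsets_def card_2_iff)
  obtain A where A: "A \<in> C" "a \<in> A" using C ab by (auto simp: partition_on_def)
  obtain B where B: "B \<in> C" "b \<in> B" using C ab by (auto simp: partition_on_def)
  have mem_iff: "a \<in> S \<longleftrightarrow> S = A" "b \<in> S \<longleftrightarrow> S = B" if "S \<in> C" for S
    using that A B C by (auto simp: partition_on_def disjoint_def)
  have card_int: "card (e \<inter> S) = (if a \<in> S then 1 else 0) + (if b \<in> S then 1 else 0)" for S
    using ab by (auto simp: Int_insert_left)
  \<comment> \<open>The sum of the two indicators is 1 when exactly one of them is, hence the
    exclusive or.\<close>
  have "{S \<in> C. card (e \<inter> S) = 1} = {S \<in> C. (S = A) \<noteq> (S = B)}"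
    unfolding card_int by (intro Collect_cong conj_cong refl) (simp add: mem_iff)
  also have "\<dots> = (if A = B then {} else {A, B})"
    using A B by auto
  finally have "card {S \<in> C. card (e \<inter> S) = 1} = (if A = B then 0 else 2)"
    by simp
  moreover have "(\<exists>S \<in> C. e \<subseteq> S) \<longleftrightarrow> A = B"
    using A B ab mem_iff by auto
  ultimately show ?thesis by simp
qed

text \<open>Double counting of pairs of a cluster and an edge that it cuts.\<close>

lemma sum_cut_eq:
  assumes "finite_simple_graph V E" "partition_on V C"
  shows "(\<Sum>S \<in> C. cut E S) = 2 * card (inter_edges E C)"
proof -
  note G = finite_simple_graphD[OF assms(1)]
  have finC: "finite C" using finite_elements[OF G(1) assms(2)] .
  have "(\<Sum>S \<in> C. cut E S) = (\<Sum>S \<in> C. \<Sum>e \<in> E. if card (e \<inter> S) = 1 then 1 else 0)"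
    using G(2) by (simp add: cut_def sum.If_cases Int_def)
  also have "\<dots> = (\<Sum>e \<in> E. \<Sum>S \<in> C. if card (e \<inter> S) = 1 then 1 else 0)"
    by (rule sum.swap)
  also have "\<dots> = (\<Sum>e \<in> E. card {S \<in> C. card (e \<inter> S) = 1})"
    using finC by (simp add: sum.If_cases Int_def)
  also have "\<dots> = (\<Sum>e \<in> E. if \<exists>S \<in> C. e \<subseteq> S then 0 else 2)"
    by (intro sum.cong refl card_clusters_meeting_edge_once[OF assms(2)] subsetD[OF G(3)])
  also have "\<dots> = 2 * card (inter_edges E C)"
    using G(2) by (simp add: sum.If_cases inter_edges_def Int_def)
  finally show ?thesis .
qed

text \<open>The factor 1/2 in the objective cancels the double count, so the objective is affine in
  \<open>l\<close> with natural number coefficients.\<close>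

lemma LamPrime_eq:
  fixes l :: real
  assumes "finite_simple_graph V E" "partition_on V C"
  shows "LamPrime E C l = real (card (inter_edges E C)) + l * real (intra_pairs C)"
proof -
  have "LamPrime E C l = 1 / 2 * real (\<Sum>S \<in> C. cut E S) + l * real (intra_pairs C)"
    by (simp add: LamPrime_def intra_pairs_def sum.distrib sum_distrib_left)
  then show ?thesis by (simp add: sum_cut_eq[OF assms])
qed

lemma card_edges_eq:
  assumes "finite_simple_graph V E" "partition_on V C"
  shows "card E = card (inter_edges E C) + (\<Sum>S \<in> C. card {e \<in> E. e \<subseteq> S})"
proof -
  note G = finite_simple_graphD[OF assms(1)]
  have finC: "finite C" using finite_elements[OF G(1) assms(2)] .
  have disj: "{e \<in> E. e \<subseteq> S} \<inter> {e \<in> E. e \<subseteq> T} = {}" if "S \<in> C" "T \<in> C" "S \<noteq> T" for S T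
  proof -
    have "S \<inter> T = {}" using that assms(2) by (auto simp: partition_on_def disjoint_def)
    \<comment> \<open>An empty edge would lie in both \<open>S\<close> and \<open>T\<close>.\<close>
    moreover have "e \<noteq> {}" if "e \<in> E" for e using that G(3) by (auto simp: nsets_def)
    ultimately show ?thesis by blast
  qed
  have "card (\<Union>S \<in> C. {e \<in> E. e \<subseteq> S}) = (\<Sum>S \<in> C. card {e \<in> E. e \<subseteq> S})"
    using finC G(2) disj by (intro card_UN_disjoint) auto
  moreover have "E = inter_edges E C \<union> (\<Union>S \<in> C. {e \<in> E. e \<subseteq> S})"
    by (auto simp: inter_edges_def)
  moreover have "card (inter_edges E C \<union> (\<Union>S \<in> C. {e \<in> E. e \<subseteq> S}))
      = card (inter_edges E C) + card (\<Union>S \<in> C. {e \<in> E. e \<subseteq> S})"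
    using G(2) finC by (intro card_Un_disjoint) (auto simp: inter_edges_def)
  ultimately show ?thesis by simp
qed

text \<open>The edges inside a cluster are among its vertex pairs.\<close>

lemma card_edges_le:
  assumes "finite_simple_graph V E" "partition_on V C"
  shows "card E \<le> card (inter_edges E C) + intra_pairs C"
proof -
  note G = finite_simple_graphD[OF assms(1)]
  have "card {e \<in> E. e \<subseteq> S} \<le> card S choose 2" if "S \<in> C" for S
  proof -
    have "finite S"
      using that G(1) assms(2) by (auto simp: partition_on_def intro: finite_subset)
    then have "card {e \<in> E. e \<subseteq> S} \<le> card (nsets S 2)"
      using G(3) by (intro card_mono finite_imp_finite_nsets) (auto simp: nsets_def)
    then show ?thesis by simp
  qed
  then show ?thesis
    using card_edges_eq[OF assms] by (simp add: intra_pairs_def sum_mono)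
qed

text \<open>In a clique every vertex pair is an edge, so the bound of \<open>card_edges_le\<close>
  is attained.\<close>

lemma card_edges_eq_cliques:
  assumes "finite_simple_graph V E" "partition_on V C" "\<And>S. S \<in> C \<Longrightarrow> clique S E"
  shows "card E = card (inter_edges E C) + intra_pairs C"
proof -
  note G = finite_simple_graphD[OF assms(1)]
  have "card {e \<in> E. e \<subseteq> S} = card S choose 2" if "S \<in> C" for S
  proof -
    have "{e \<in> E. e \<subseteq> S} = nsets S 2"
      using G(1,3) assms(3)[OF that] by (auto simp: nsets_def clique_def card_2_iff)
    then show ?thesis by simp
  qed
  then show ?thesis
    using card_edges_eq[OF assms(1,2)] by (simp add: intra_pairs_def)
qed

lemma partition_on_connected_components: "partition_on V (connected_components V E)"
proof -
  \<comment> \<open>The closure is reflexive on the whole type and \<open>E\<close> is arbitrary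
    here, so paths may leave \<open>V\<close>; hence the restriction.\<close>
  define r where "r = (adj_rel E)\<^sup>* \<inter> V \<times> V"
  have "sym ((adj_rel E)\<^sup>*)"
    by (intro sym_rtrancl) (auto simp: adj_rel_def sym_def insert_commute)
  then have "equiv V r"
    unfolding r_def by (intro equivI) (auto simp: refl_on_def sym_def trans_def)
  moreover have "connected_components V E = V // r"
    by (auto simp: connected_components_def quotient_def r_def)
  ultimately show ?thesis by (simp add: partition_on_quotient)
qed

lemma cluster_graph_singleton: "cluster_graph V {{a, b}}"
proof -
  \<comment> \<open>A walk can only go back and forth along the single edge.\<close>
  have "u = v \<or> {u, v} = {a, b}" if "(u, v) \<in> (adj_rel {{a, b}})\<^sup>*" for u v
    using that by induction (auto simp: adj_rel_def doubleton_eq_iff)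
  then show ?thesis
    unfolding cluster_graph_def connected_components_def clique_def
    by (auto simp: doubleton_eq_iff)
qed

text \<open>One edge can always be kept: a graph with a single edge is a cluster graph.\<close>

lemma cluster_deletion_value_less:
  assumes "finite_simple_graph V E" "E \<noteq> {}"
  shows "cluster_deletion_value V E < card E"
proof -
  note G = finite_simple_graphD[OF assms(1)]
  obtain e where e: "e \<in> E" using assms(2) by auto
  then obtain a b where "e = {a, b}" using G(3) by (auto simp: nsets_def card_2_iff)
  moreover have "E - (E - {e}) = {e}" using e by auto
  ultimately have "cluster_graph V (E - (E - {e}))" by (simp add: cluster_graph_singleton)
  then have "cluster_deletion_value V E \<le> card (E - {e})"
    unfolding cluster_deletion_value_def by (intro Least_le exI[of _ "E - {e}"]) auto
  also have "\<dots> < card E" using e G(2) by (intro psubset_card_mono) auto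
  finally show ?thesis .
qed

text \<open>The clusters are the components left by a minimum deletion \<open>R\<close>. An edge
  outside \<open>R\<close> joins its ends within one component, so every edge between clusters was
  deleted.\<close>

lemma cluster_deletion_clustering:
  assumes "finite_simple_graph V E" "E \<noteq> {}"
  obtains C where "partition_on V C" "\<And>S. S \<in> C \<Longrightarrow> clique S E"
    "card (inter_edges E C) \<le> cluster_deletion_value V E"
proof -
  note G = finite_simple_graphD[OF assms(1)]
  \<comment> \<open>Deleting all edges shows that the minimum is taken over a nonempty set, as
    \<open>LeastI\<close> requires.\<close>
  have "\<exists>R \<subseteq> E. card R = card E \<and> cluster_graph V (E - R)"
    by (intro exI[of _ E]) (auto simp: cluster_graph_def connected_components_def clique_def adj_rel_def)
  then have "\<exists>R \<subseteq> E. card R = cluster_deletion_value V E \<and> cluster_graph V (E - R)"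
    unfolding cluster_deletion_value_def by (rule LeastI)
  then obtain R where R: "R \<subseteq> E" "card R = cluster_deletion_value V E" "cluster_graph V (E - R)"
    by blast
  define C where "C = connected_components V (E - R)"
  have "inter_edges E C \<subseteq> R"
  proof
    fix e assume e: "e \<in> inter_edges E C"
    then obtain a b where ab: "e = {a, b}" "a \<in> V" "b \<in> V"
      using G(3) by (auto simp: inter_edges_def nsets_def card_2_iff)
    show "e \<in> R"
    proof (rule ccontr)
      assume "e \<notin> R"
      then have "(a, b) \<in> (adj_rel (E - R))\<^sup>*"
        using e ab by (auto simp: adj_rel_def inter_edges_def)
      then have "e \<subseteq> {v \<in> V. (a, v) \<in> (adj_rel (E - R))\<^sup>*}" using ab by auto
      then show False
        using e ab unfolding inter_edges_def C_def connected_components_def by blast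
    qed
  qed
  then have "card (inter_edges E C) \<le> cluster_deletion_value V E"
    using R G(2) by (metis card_mono finite_subset)
  moreover have "clique S E" if "S \<in> C" for S
    using R(3) that by (auto simp: C_def cluster_graph_def clique_def)
  ultimately show ?thesis
    using that partition_on_connected_components C_def by blast
qed

lemma optimal_clustering_exists:
  assumes "finite V"
  obtains C where "optimal_clustering V E l C"
proof -
  let ?P = "{C. partition_on V C}" and ?f = "\<lambda>C. LamPrime E C l"
  have fin: "finite ?P" using finitely_many_partition_on[OF assms] .
  \<comment> \<open>Components serve here merely as some partition of \<open>V\<close>.\<close>
  have ne: "?P \<noteq> {}" using partition_on_connected_components by auto
  have "optimal_clustering V E l (arg_min_on ?f ?P)"
    using arg_min_if_finite(1)[OF fin ne] arg_min_least[OF fin ne]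
    by (auto simp: optimal_clustering_def)
  then show ?thesis using that by blast
qed

lemma optimal_clustering_inter_edges_le:
  assumes "finite_simple_graph V E" "E \<noteq> {}" "0 < l" "l < 1" "optimal_clustering V E l C"
  shows "card (inter_edges E C) \<le> cluster_deletion_value V E"
proof -
  obtain D where D: "partition_on V D" "\<And>S. S \<in> D \<Longrightarrow> clique S E"
      "card (inter_edges E D) \<le> cluster_deletion_value V E"
    using cluster_deletion_clustering[OF assms(1,2)] by blast
  have C: "partition_on V C" using assms(5) by (simp add: optimal_clustering_def)
  have "LamPrime E C l \<le> LamPrime E D l"
    using assms(5) D(1) by (simp add: optimal_clustering_def)
  then have le: "real (card (inter_edges E C)) + l * real (intra_pairs C)
      \<le> real (card (inter_edges E D)) + l * real (intra_pairs D)"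
    by (simp add: LamPrime_eq[OF assms(1)] C D(1))
  \<comment> \<open>Both sides are compared through \<open>card E\<close>: equality for the cliques
    of \<open>D\<close>, an inequality for \<open>C\<close>.\<close>
  have "real (intra_pairs D)
      \<le> real (intra_pairs C) + real (card (inter_edges E C)) - real (card (inter_edges E D))"
    using card_edges_eq_cliques[OF assms(1) D(1,2)] card_edges_le[OF assms(1) C] by linarith
  then have "l * real (intra_pairs D)
      \<le> l * (real (intra_pairs C) + real (card (inter_edges E C)) - real (card (inter_edges E D)))"
    using assms(3) by (intro mult_left_mono) auto
  \<comment> \<open>Substituting into \<open>le\<close> cancels the term
    \<open>l * real (intra_pairs C)\<close>.\<close>
  then have "(1 - l) * real (card (inter_edges E C)) \<le> (1 - l) * real (card (inter_edges E D))"
    using le by (simp add: algebra_simps)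
  then show ?thesis using assms(4) D(3) by simp
qed

theorem theorem2:
  fixes V :: "'a set" and E :: "'a set set"
  assumes "finite_simple_graph V E" and "E \<noteq> {}"
  shows "(\<exists>F :: 'a set set set.
            finite F \<and> card F \<le> cluster_deletion_value V E + 1 \<and>
            (\<forall>C \<in> F. partition_on V C) \<and>
            (\<forall>l :: real. 0 < l \<and> l < 1 \<longrightarrow> (\<exists>C \<in> F. optimal_clustering V E l C))) \<and>
         cluster_deletion_value V E + 1 \<le> card E"
proof -
  define c where "c = cluster_deletion_value V E"
  define P where "P k C \<longleftrightarrow> partition_on V C \<and> card (inter_edges E C) = k" for k C
  \<comment> \<open>Only attained values \<open>k\<close> are kept: for the others
    \<open>best k\<close> is an unspecified value and need not be a partition.\<close>
  define X where "X = {k. k \<le> c \<and> (\<exists>C. P k C)}"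
  define best where "best k = arg_min intra_pairs (P k)" for k
  have best: "P k (best k)" "\<And>D. P k D \<Longrightarrow> intra_pairs (best k) \<le> intra_pairs D" if "P k C" for k C
    unfolding best_def using that by (auto intro: arg_min_natI arg_min_nat_le)
  have X: "X \<subseteq> {..c}" by (auto simp: X_def)
  have "finite (best ` X)" using X finite_subset by blast
  moreover have "card (best ` X) \<le> c + 1"
    using card_image_le[of X best] card_mono[OF _ X] X finite_subset[OF X] by simp
  moreover have "partition_on V C" if "C \<in> best ` X" for C
    using that best(1) by (auto simp: X_def P_def)
  moreover have "\<exists>C \<in> best ` X. optimal_clustering V E l C" if l: "0 < l" "l < 1" for l
  proof -
    obtain C where C: "optimal_clustering V E l C"
      using optimal_clustering_exists finite_simple_graphD(1)[OF assms(1)] by blast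
    define k where "k = card (inter_edges E C)"
    have Ck: "P k C" using C by (simp add: P_def k_def optimal_clustering_def)
    have "k \<le> c"
      unfolding k_def c_def using optimal_clustering_inter_edges_le[OF assms l C] .
    then have "k \<in> X" using Ck by (auto simp: X_def)
    \<comment> \<open>Both clusterings have \<open>k\<close> edges between clusters, so only the
      pair counts differ, and \<open>l\<close> is positive. The choice of \<open>best k\<close> does
      not depend on \<open>l\<close>, so one family serves all parameters.\<close>
    have "LamPrime E (best k) l \<le> LamPrime E C l"
      using best[OF Ck] Ck l by (simp add: LamPrime_eq[OF assms(1)] P_def)
    then have "optimal_clustering V E l (best k)"
      using C best(1)[OF Ck] order_trans unfolding optimal_clustering_def P_def by blast
    then show ?thesis using \<open>k \<in> X\<close> by blast
  qed
  ultimately show ?thesis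
    using cluster_deletion_value_less[OF assms] unfolding c_def
    by (intro conjI exI[of _ "best ` X"]) auto
qed

end
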